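(* If $P$ is unbounded, then convergence of $S_r$ to $\mathcal{S}$ may not be finite even if $\rho(G)<1$ and the origin is in the interior of $P$. That is: there exist positive integers $n,m$ and $A\in\mathbb{R}^{m\times n}$, $b\in\mathbb{R}^m$, $G\in\mathbb{R}^{n\times n}$ such that $\rho(G)<1$, the polyhedron $P=\{x\in\mathbb{R}^n\mid Ax\le b\}$ is unbounded and contains the origin in its interior, and $S_r\setminus\mathcal{S}\ne\emptyset$ for every positive integer $r$.
   Context: Here $\rho(G)$ is the spectral radius of $G$ (largest absolute value of its eigenvalues), $S_r:=\bigcap_{k=0}^{r}\{x\in\mathbb{R}^n \mid AG^kx\le b\}$ for $r\geq 0$, and $\mathcal{S}:=\bigcap_{k=0}^{\infty}\{x\in\mathbb{R}^n \mid AG^kx\le b\}$. Inequalities between vectors are entrywise. Convergence of $S_r$ to $\mathcal S$ is called not finite if $S_r\setminus\mathcal{S}\neq\emptyset$ for all positive integers $r$. *)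

theory Defs
  imports
    "HOL-Analysis.Abstract_Metric_Spaces"
    "HOL-Analysis.L2_Norm"
    "Jordan_Normal_Form.Spectral_Radius"
begin

text \<open>Type-indexed vectors of HOL-Analysis are not used; \<open>$\<close> indexes \<open>Matrix.vec\<close>.\<close>

unbundle no vec_syntax

text \<open>
  \<open>\<real>\<^sup>n\<close> is \<open>carrier_vec n :: real vec set\<close>, so that the dimensions can be quantified over
  inside a formula. As \<open>real vec\<close> has no topology, boundedness and interior are those of the
  Euclidean metric on this carrier.
\<close>

definition vec_dist :: "nat \<Rightarrow> real Matrix.vec \<Rightarrow> real Matrix.vec \<Rightarrow> real" where
  "vec_dist n x y = L2_set (\<lambda>i. x $ i - y $ i) {..<n}"

lemma Metric_space_vec_dist: "Metric_space (carrier_vec n) (vec_dist n)"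
proof
  fix x y z :: "real Matrix.vec"
  show "0 \<le> vec_dist n x y"
    by (simp add: vec_dist_def)
  show "vec_dist n x y = vec_dist n y x"
    by (simp add: vec_dist_def L2_set_def power2_commute)
  show "vec_dist n x y = 0 \<longleftrightarrow> x = y" if "x \<in> carrier_vec n" "y \<in> carrier_vec n"
    using that by (auto simp: vec_dist_def L2_set_eq_0_iff)
  show "vec_dist n x z \<le> vec_dist n x y + vec_dist n y z"
    using L2_set_triangle_ineq[of "\<lambda>i. x $ i - y $ i" "\<lambda>i. y $ i - z $ i" "{..<n}"]
    by (simp add: vec_dist_def)
qed

definition bounded_vec_set :: "nat \<Rightarrow> real Matrix.vec set \<Rightarrow> bool" where
  "bounded_vec_set n X \<longleftrightarrow> Metric_space.mbounded (carrier_vec n) (vec_dist n) X"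

definition interior_vec_set :: "nat \<Rightarrow> real Matrix.vec set \<Rightarrow> real Matrix.vec set" where
  "interior_vec_set n X = Metric_space.mtopology (carrier_vec n) (vec_dist n) interior_of X"

text \<open>The order \<open>\<le>\<close> on \<open>real vec\<close> is the entrywise one.\<close>

definition ineq_set :: "nat \<Rightarrow> real mat \<Rightarrow> real Matrix.vec \<Rightarrow> real Matrix.vec set" where
  "ineq_set n A b = {x \<in> carrier_vec n. A *\<^sub>v x \<le> b}"

definition S_upto :: "nat \<Rightarrow> real mat \<Rightarrow> real Matrix.vec \<Rightarrow> real mat \<Rightarrow> nat \<Rightarrow> real Matrix.vec set" where
  "S_upto n A b G r = (\<Inter>k\<in>{0..r}. ineq_set n (A * G ^\<^sub>m k) b)"

definition S_limit :: "nat \<Rightarrow> real mat \<Rightarrow> real Matrix.vec \<Rightarrow> real mat \<Rightarrow> real Matrix.vec set" where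
  "S_limit n A b G = (\<Inter>k. ineq_set n (A * G ^\<^sub>m k) b)"

text \<open>The eigenvalues of a real matrix are its complex ones.\<close>

definition real_spectral_radius :: "real mat \<Rightarrow> real" where
  "real_spectral_radius G = spectral_radius (map_mat complex_of_real G)"

end

theory Submission
  imports Defs
begin

text \<open>
  In the plane take \<open>G = diag(1/2, 1/4)\<close> and let \<open>P\<close> be the half-plane
  \<open>x\<^sub>0 + x\<^sub>1 \<le> 1\<close>, which is unbounded and has the origin in its interior. The constraint
  contributed by \<open>G\<^sup>k\<close> is \<open>t x\<^sub>0 + t\<^sup>2 x\<^sub>1 \<le> 1\<close> with \<open>t = 2\<^sup>-\<^sup>k\<close>. Its coefficient vector
  \<open>(t, t\<^sup>2)\<close> lies on a parabola through the origin; by strict convexity no such vector belongs to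
  the convex hull of the origin and the earlier vectors, so no constraint is implied by its
  predecessors.

  A point violating the constraint for \<open>s = 2\<^sup>-\<^sup>r\<^sup>-\<^sup>1\<close> but none of the earlier ones is found as
  a concave quadratic in \<open>t\<close>. The graph of \<open>t x\<^sub>0 + t\<^sup>2 x\<^sub>1\<close> passes through the origin, and its
  value exceeds \<open>1\<close> exactly between \<open>s/2\<close> and \<open>2s\<close> if
  \<open>t x\<^sub>0 + t\<^sup>2 x\<^sub>1 = 1 - (t - s/2) (t - 2s) / s\<^sup>2\<close>, that is, if
  \<open>x = (5/(2s), -1/s\<^sup>2)\<close>. This interval contains \<open>s\<close>, whereas all earlier \<open>t\<close> are at least
  \<open>2s\<close>.
\<close>

definition contraction :: "real mat" where
  "contraction = mat_diag 2 (\<lambda>i. (1/2) ^ Suc i)"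

definition half_plane_row :: "real mat" where
  "half_plane_row = mat 1 2 (\<lambda>_. 1)"

definition half_plane_bound :: "real Matrix.vec" where
  "half_plane_bound = vec 1 (\<lambda>_. 1)"

lemma mat_diag_pow: "mat_diag n f ^\<^sub>m k = mat_diag n (\<lambda>i. (f i :: 'a :: comm_semiring_1) ^ k)"
proof (induction k)
  case 0
  show ?case by (simp add: mat_diag_def one_mat_def)
next
  case (Suc k)
  then show ?case by (simp add: mult.commute)
qed

lemma spectrum_mat_diag:
  "spectrum (mat_diag n f) = (f :: nat \<Rightarrow> 'a :: field) ` {..<n}"
proof -
  have "upper_triangular (mat_diag n f)"
    by (auto simp: mat_diag_def)
  then have cp: "char_poly (mat_diag n f) = (\<Prod>a\<leftarrow>diag_mat (mat_diag n f). [:- a, 1:])"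
    by (rule char_poly_upper_triangular[OF mat_diag_dim])
  have "set (diag_mat (mat_diag n f)) = f ` {..<n}"
    by (auto simp: diag_mat_def mat_diag_def)
  then show ?thesis
    using spectrum_root_char_poly[OF mat_diag_dim, of n f]
    by (auto simp: cp poly_prod_list prod_list_zero_iff)
qed

lemma real_spectral_radius_mat_diag_less:
  assumes "n > 0" and "\<And>i. i < n \<Longrightarrow> \<bar>f i\<bar> < c"
  shows "real_spectral_radius (mat_diag n f) < c"
proof -
  have "map_mat complex_of_real (mat_diag n f) = mat_diag n (\<lambda>i. complex_of_real (f i))"
    by (rule eq_matI) (auto simp: mat_diag_def)
  then have "real_spectral_radius (mat_diag n f)
      \<in> norm ` (\<lambda>i. complex_of_real (f i)) ` {..<n}"
    using spectral_radius_mem_max(1)[OF mat_diag_dim \<open>n > 0\<close>, of "\<lambda>i. complex_of_real (f i)"]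
    by (simp add: real_spectral_radius_def spectrum_mat_diag)
  then show ?thesis using assms(2) by auto
qed

lemma mem_iterated_half_plane_iff:
  "x \<in> ineq_set 2 (half_plane_row * contraction ^\<^sub>m k) half_plane_bound \<longleftrightarrow>
    x \<in> carrier_vec 2 \<and> (1/2) ^ k * x $ 0 + ((1/2) ^ k)\<^sup>2 * x $ 1 \<le> 1"
proof -
  have "half_plane_row * contraction ^\<^sub>m k = mat 1 2 (\<lambda>(i, j). ((1/2) ^ Suc j) ^ k)"
    unfolding contraction_def mat_diag_pow
    by (subst mat_diag_mult_right[of _ 1]) (auto simp: half_plane_row_def)
  moreover have "((1/4) ^ k :: real) = ((1/2) ^ k)\<^sup>2"
    by (simp add: power_mult_distrib[symmetric] power2_eq_square)
  ultimately show ?thesis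
    by (auto simp: ineq_set_def half_plane_bound_def less_eq_vec_def scalar_prod_def
        numeral_2_eq_2 lessThan_Suc atLeast0LessThan power_one_over)
qed

lemma mem_half_plane_iff:
  "x \<in> ineq_set 2 half_plane_row half_plane_bound \<longleftrightarrow> x \<in> carrier_vec 2 \<and> x $ 0 + x $ 1 \<le> 1"
proof -
  have "half_plane_row * contraction ^\<^sub>m 0 = half_plane_row"
    by (simp add: half_plane_row_def contraction_def mat_diag_def)
  then show ?thesis using mem_iterated_half_plane_iff[of x 0] by simp
qed

lemma abs_component_diff_le_vec_dist:
  assumes "i < n"
  shows "\<bar>x $ i - y $ i\<bar> \<le> vec_dist n x y"
proof -
  have "vec_dist n x y = L2_set (\<lambda>i. \<bar>x $ i - y $ i\<bar>) {..<n}"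
    by (simp add: vec_dist_def L2_set_def)
  then show ?thesis
    using assms member_le_L2_set[of "{..<n}" i "\<lambda>i. \<bar>x $ i - y $ i\<bar>"] by simp
qed

lemma bounded_vec_set_component:
  assumes "bounded_vec_set n X" and "i < n"
  obtains C where "\<And>x. x \<in> X \<Longrightarrow> \<bar>x $ i\<bar> \<le> C"
proof -
  interpret Metric_space "carrier_vec n" "vec_dist n" by (rule Metric_space_vec_dist)
  obtain c B where sub: "X \<subseteq> mcball c B"
    using assms(1) by (auto simp: bounded_vec_set_def mbounded_def)
  have "\<bar>x $ i\<bar> \<le> \<bar>c $ i\<bar> + B" if "x \<in> X" for x
    using that sub abs_component_diff_le_vec_dist[OF assms(2), of c x] by (force simp: subset_iff)
  then show ?thesis by (rule that)
qed

lemma not_bounded_half_plane: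
  "\<not> bounded_vec_set 2 (ineq_set 2 half_plane_row half_plane_bound)"
proof
  assume "bounded_vec_set 2 (ineq_set 2 half_plane_row half_plane_bound)"
  then obtain C where
    C: "\<And>x. x \<in> ineq_set 2 half_plane_row half_plane_bound \<Longrightarrow> \<bar>x $ 0\<bar> \<le> C"
    by (rule bounded_vec_set_component[of 2 _ 0]) auto
  have "vec 2 (\<lambda>i. if i = 0 then - \<bar>C\<bar> - 1 else 0) \<in> ineq_set 2 half_plane_row half_plane_bound"
    by (simp add: mem_half_plane_iff)
  from C[OF this] show False by simp
qed

lemma zero_in_interior_half_plane:
  "0\<^sub>v 2 \<in> interior_vec_set 2 (ineq_set 2 half_plane_row half_plane_bound)"
proof -
  interpret Metric_space "carrier_vec 2" "vec_dist 2" by (rule Metric_space_vec_dist)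
  have "x $ 0 + x $ 1 \<le> 1" if "vec_dist 2 (0\<^sub>v 2) x < 1/2" for x
    using that abs_component_diff_le_vec_dist[of 0 2 "0\<^sub>v 2" x]
      abs_component_diff_le_vec_dist[of 1 2 "0\<^sub>v 2" x] by simp
  then have "mball (0\<^sub>v 2) (1/2) \<subseteq> ineq_set 2 half_plane_row half_plane_bound"
    by (auto simp: mem_half_plane_iff)
  then have "mball (0\<^sub>v 2) (1/2) \<subseteq> mtopology interior_of ineq_set 2 half_plane_row half_plane_bound"
    by (rule interior_of_maximal[OF _ openin_mball])
  moreover have "0\<^sub>v 2 \<in> mball (0\<^sub>v 2) (1/2)" by simp
  ultimately show ?thesis unfolding interior_vec_set_def by blast
qed

text \<open>
  Writing \<open>u = t/s\<close>, the constraint functional at the separating point is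
  \<open>(5/2) u - u\<^sup>2 = 1 - (u - 1/2) (u - 2)\<close>. Earlier constraints have \<open>u \<ge> 2\<close>, and the new one
  has \<open>u = 1\<close>, with value \<open>3/2\<close>.
\<close>

lemma S_upto_minus_S_limit_nonempty:
  "S_upto 2 half_plane_row half_plane_bound contraction r -
    S_limit 2 half_plane_row half_plane_bound contraction \<noteq> {}"
proof -
  define w :: real where "w = 2 ^ Suc r"
  define x where "x = vec 2 (\<lambda>i. if i = 0 then 5/2 * w else - w\<^sup>2)"
  have x: "x \<in> carrier_vec 2" "x $ 0 = 5/2 * w" "x $ 1 = - w\<^sup>2"
    by (simp_all add: x_def)
  have functional: "t * x $ 0 + t\<^sup>2 * x $ 1 = 1 - (t * w - 1/2) * (t * w - 2)" for t
    unfolding x by (simp add: power2_eq_square algebra_simps)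
  have "x \<in> ineq_set 2 (half_plane_row * contraction ^\<^sub>m k) half_plane_bound" if "k \<le> r" for k
  proof -
    have "(1/2) ^ k * w = 2 ^ (Suc r - k)"
      using that by (simp add: w_def power_diff power_one_over)
    also have "\<dots> \<ge> 2 ^ 1"
      using that by (intro power_increasing) auto
    finally have "(1/2) ^ k * w \<ge> 2" by simp
    then have "((1/2) ^ k * w - 1/2) * ((1/2) ^ k * w - 2) \<ge> 0"
      by (intro mult_nonneg_nonneg) auto
    then show ?thesis
      using x(1) by (simp only: mem_iterated_half_plane_iff functional) simp
  qed
  then have "x \<in> S_upto 2 half_plane_row half_plane_bound contraction r"
    by (simp add: S_upto_def)
  moreover have "x \<notin> ineq_set 2 (half_plane_row * contraction ^\<^sub>m Suc r) half_plane_bound"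
  proof -
    have "(1/2) ^ Suc r * w = 1" by (simp add: w_def power_one_over)
    then show ?thesis by (simp only: mem_iterated_half_plane_iff functional) simp
  qed
  then have "x \<notin> S_limit 2 half_plane_row half_plane_bound contraction"
    unfolding S_limit_def by blast
  ultimately show ?thesis by blast
qed

theorem proposition2p6:
  shows "\<exists>(n::nat) (m::nat) (A::real mat) (b::real Matrix.vec) (G::real mat).
    n > 0 \<and> m > 0 \<and>
    A \<in> carrier_mat m n \<and> b \<in> carrier_vec m \<and> G \<in> carrier_mat n n \<and>
    real_spectral_radius G < 1 \<and>
    \<not> bounded_vec_set n (ineq_set n A b) \<and>
    0\<^sub>v n \<in> interior_vec_set n (ineq_set n A b) \<and>
    (\<forall>r::nat. r > 0 \<longrightarrow> S_upto n A b G r - S_limit n A b G \<noteq> {})"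
proof (intro exI conjI allI impI)
  show "(0::nat) < 2" "(0::nat) < 1" by simp_all
  show "half_plane_row \<in> carrier_mat 1 2" by (simp add: half_plane_row_def)
  show "half_plane_bound \<in> carrier_vec 1" by (simp add: half_plane_bound_def)
  show "contraction \<in> carrier_mat 2 2" by (simp add: contraction_def)
  have "\<bar>(1/2) ^ Suc i\<bar> < (1::real)" for i
    using power_Suc_less_one[of "1/2::real" i] by simp
  then show "real_spectral_radius contraction < 1"
    unfolding contraction_def by (intro real_spectral_radius_mat_diag_less) auto
qed (rule not_bounded_half_plane zero_in_interior_half_plane S_upto_minus_S_limit_nonempty)+

end
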